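(* Let $G$ be a compactly generated locally compact group with polynomial growth, endowed with a left Haar measure $\mu$, and let $U$ be a compact generating set of $G$. Then there exist $\delta>0$ and a constant $C\geq 1$ such that $$\mu\left(U^{n+1}\smallsetminus U^n\right)\leq C\,n^{-\delta}\,\mu(U^n)\quad\text{for all integers } n\geq 1.$$ In particular, the sequence $(U^n)_{n\in\mathbf{N}}$ is Følner.
   Context: A subset $U\subset G$ is generating if $\bigcup_{n\in\mathbf{N}}U^n=G$, where $U^n=\{u_1\cdots u_n: u_i\in U\}$ ($U$ is not necessarily symmetric). $G$ has polynomial growth if there exist a compact generating set $V$ and constants $D>0$, $C_0\geq 1$ such that $\mu(V^n)\leq C_0n^D$ for all $n\geq 1$. A sequence $(A_n)_{n\in\mathbf{N}}$ of subsets of $G$ is Følner if for any compact set $Q\subset G$, $\mu(QA_n\vartriangle A_n)=o(\mu(A_n))$ as $n\to\infty$.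
   Formalization: Assumes in addition that 1 lies in both U^k and U^(k+1) for some k (false otherwise, e.g. U={-1,1} in Z); the inequality is claimed only for n with μ(U^n)>0; in the Følner condition the compact set Q is nonempty. *)

theory Defs
  imports
    "HOL-Analysis.Analysis"
    "HOL-Algebra.Coset"
    "HOL-Library.Landau_Symbols"
begin

locale topological_group = group G
  for G :: "('a, 'b) monoid_scheme" (structure) and T :: "'a topology" +
  assumes topspace_eq_carrier: "topspace T = carrier G"
    and continuous_mult: "continuous_map (prod_topology T T) T (\<lambda>(x, y). x \<otimes> y)"
    and continuous_inv: "continuous_map T T (\<lambda>x. inv x)"

(* As usual in this setting, locally compact groups are Hausdorff. *)
definition locally_compact_group :: "('a, 'b) monoid_scheme \<Rightarrow> 'a topology \<Rightarrow> bool" where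
  "locally_compact_group G T \<longleftrightarrow>
     topological_group G T \<and> Hausdorff_space T \<and> locally_compact_space T"

(* A nonzero left-invariant Radon measure on the Borel sets of G. The two regularity
   clauses are part of the usual definition when G is not second countable. *)
definition left_haar_measure ::
    "('a, 'b) monoid_scheme \<Rightarrow> 'a topology \<Rightarrow> 'a measure \<Rightarrow> bool" where
  "left_haar_measure G T \<mu> \<longleftrightarrow>
     space \<mu> = carrier G \<and>
     sets \<mu> = sigma_sets (carrier G) {V. openin T V} \<and>
     emeasure \<mu> (space \<mu>) \<noteq> 0 \<and>
     (\<forall>K. compactin T K \<longrightarrow> emeasure \<mu> K < \<infinity>) \<and>
     (\<forall>g\<in>carrier G. \<forall>A\<in>sets \<mu>. emeasure \<mu> (g <#\<^bsub>G\<^esub> A) = emeasure \<mu> A) \<and>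
     (\<forall>A\<in>sets \<mu>. emeasure \<mu> A = (INF V\<in>{V. openin T V \<and> A \<subseteq> V}. emeasure \<mu> V)) \<and>
     (\<forall>V. openin T V \<longrightarrow>
        emeasure \<mu> V = (SUP K\<in>{K. compactin T K \<and> K \<subseteq> V}. emeasure \<mu> K))"

(* The set of products of exactly n elements of U; the empty product is the identity. *)
primrec set_pow :: "('a, 'b) monoid_scheme \<Rightarrow> 'a set \<Rightarrow> nat \<Rightarrow> 'a set" where
  "set_pow G U 0 = {\<one>\<^bsub>G\<^esub>}"
| "set_pow G U (Suc n) = set_pow G U n <#>\<^bsub>G\<^esub> U"

(* Generating as a semigroup with identity: inverses of elements of U are not adjoined. *)
definition generating :: "('a, 'b) monoid_scheme \<Rightarrow> 'a set \<Rightarrow> bool" where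
  "generating G U \<longleftrightarrow> U \<subseteq> carrier G \<and> (\<Union>n. set_pow G U n) = carrier G"

definition polynomial_growth ::
    "('a, 'b) monoid_scheme \<Rightarrow> 'a topology \<Rightarrow> 'a measure \<Rightarrow> bool" where
  "polynomial_growth G T \<mu> \<longleftrightarrow>
     (\<exists>V D C0. compactin T V \<and> generating G V \<and> D > (0::real) \<and> C0 \<ge> (1::real) \<and>
        (\<forall>n\<ge>1. emeasure \<mu> (set_pow G V n) \<le> ennreal (C0 * real n powr D)))"

(* The empty Q has to be excluded, since then the symmetric difference is A n itself.
   The membership in fmeasurable ensures that measure returns the true values of \<mu>
   instead of its default value 0. *)
definition folner ::
    "('a, 'b) monoid_scheme \<Rightarrow> 'a topology \<Rightarrow> 'a measure \<Rightarrow> (nat \<Rightarrow> 'a set) \<Rightarrow> bool" where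
  "folner G T \<mu> A \<longleftrightarrow>
     (\<forall>n. A n \<in> fmeasurable \<mu>) \<and>
     (\<forall>Q. compactin T Q \<and> Q \<noteq> {} \<longrightarrow>
        (\<forall>n. Q <#>\<^bsub>G\<^esub> A n \<in> fmeasurable \<mu>) \<and>
        (\<lambda>n. measure \<mu> (((Q <#>\<^bsub>G\<^esub> A n) - A n) \<union> (A n - (Q <#>\<^bsub>G\<^esub> A n))))
          \<in> o(\<lambda>n. measure \<mu> (A n)))"

end

theory Submission
  imports Defs
begin

text \<open>
  Write \<open>A n\<close> for the \<open>n\<close>-th power of \<open>U\<close>. Let \<open>W\<close> be the compact set obtained from \<open>U\<close> by adding
  \<open>\<one>\<close> and the inverses, so that the sets \<open>y W\<^sup>t\<close> are the balls of a left-invariant word metric.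
  The proof compares the annuli \<open>A n - A (n - t)\<close> for \<open>t\<close> running through a geometric progression.

  A point \<open>x\<close> of \<open>A n - A (n - t)\<close> is a product of \<open>n\<close> elements of \<open>U\<close>. Truncating this product at
  distance comparable to \<open>t\<close> from its end gives a point \<open>y\<close> near \<open>x\<close> whose ball \<open>y W\<^sup>t\<close> lies in the
  next annulus \<open>A (n - t) - A (n - M t)\<close>, for a constant \<open>M\<close>: the ball cannot leave \<open>A (n - t)\<close>
  because \<open>W\<close> lies in a fixed power of \<open>U\<close>, and it cannot reach \<open>A (n - M t)\<close> because otherwise \<open>x\<close>
  would be a shorter product. A maximal disjoint family of such balls shows that the outer annulus
  has at most \<open>K = \<mu> (W\<^bsup>M t\<^esup>) / \<mu> (W\<^sup>t)\<close> times the measure of the next one (\<open>annulus_packing\<close>).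
  Hence the measure of \<open>A n - A (n - t)\<close> grows at least by the factor \<open>1 + 1 / K\<close> when \<open>t\<close> is
  replaced by \<open>M t\<close>.

  Up to \<open>t = n\<close> there are about \<open>ln n / ln M\<close> scales \<open>t = M\<^sup>i t\<^sub>0\<close>. Polynomial growth of \<open>W\<close> does not
  bound \<open>K\<close> at each single scale, but the product of the values of \<open>K\<close> telescopes and is at most
  polynomial in \<open>n\<close>; so \<open>K\<close> is bounded on average, in the logarithmic sense, and the product of the
  factors \<open>1 + 1 / K\<close> is at least a positive power of \<open>n\<close> (\<open>polynomial_decay_by_scales\<close>). As the
  largest annulus has measure at most \<open>\<mu> (A n)\<close>, each annulus of fixed width has measure
  \<open>O(n\<^bsup>-\<delta>\<^esup> \<mu> (A n))\<close> (\<open>annulus_decay\<close>).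

  Polynomial growth of one compact generating set passes to every compact set, and \<open>W\<close> lies in all
  large powers of \<open>U\<close>, because a compact generating set absorbs every compact set: this is Baire's
  theorem (\<open>compact_subset_Union_set_pow\<close>) together with the aperiodicity of \<open>U\<close>. The same
  absorption gives the Folner property: for nonempty compact \<open>Q\<close>, the set \<open>Q A n\<close> lies between \<open>A (n - m)\<close>
  and \<open>A (n + j)\<close> for constants \<open>m\<close> and \<open>j\<close>.
\<close>

section \<open>Powers of a subset of a group\<close>

context group
begin

lemma set_pow_closed: "U \<subseteq> carrier G \<Longrightarrow> set_pow G U n \<subseteq> carrier G"
  by (induction n) (simp_all add: set_mult_closed)

lemma set_pow_1: "U \<subseteq> carrier G \<Longrightarrow> set_pow G U 1 = U"
  by (force simp: set_mult_def)

lemma set_pow_add: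
  assumes "U \<subseteq> carrier G"
  shows "set_pow G U (m + n) = set_pow G U m <#> set_pow G U n"
proof (induction n)
  case 0
  have "set_pow G U m \<subseteq> carrier G"
    using assms by (rule set_pow_closed)
  then show ?case
    by (force simp: set_mult_def)
next
  case (Suc n)
  then show ?case
    using assms by (simp add: set_mult_assoc set_pow_closed)
qed

lemma set_pow_addI:
  assumes "U \<subseteq> carrier G" "x \<in> set_pow G U m" "y \<in> set_pow G U n" "k = m + n"
  shows "x \<otimes> y \<in> set_pow G U k"
  using assms by (auto simp: set_pow_add set_mult_def)

lemma set_pow_addE:
  assumes "U \<subseteq> carrier G" "x \<in> set_pow G U k" "k = m + n"
  obtains y z where "y \<in> set_pow G U m" "z \<in> set_pow G U n" "x = y \<otimes> z"
  using assms by (auto simp: set_pow_add set_mult_def)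

lemma set_pow_mono: "U \<subseteq> U' \<Longrightarrow> set_pow G U n \<subseteq> set_pow G U' n"
  by (induction n) (auto intro: mono_set_mult[THEN subsetD])

lemma set_pow_mult:
  assumes "U \<subseteq> carrier G"
  shows "set_pow G U (m * n) = set_pow G (set_pow G U m) n"
proof (induction n)
  case (Suc n)
  have "set_pow G U (m * Suc n) = set_pow G U (m * n + m)"
    by (simp add: add.commute)
  then show ?case
    using Suc assms by (simp only: set_pow_add set_pow.simps)
qed simp

lemma set_pow_subset_add:
  assumes "U \<subseteq> carrier G" "\<one> \<in> set_pow G U d"
  shows "set_pow G U n \<subseteq> set_pow G U (n + d)"
proof
  fix x assume x: "x \<in> set_pow G U n"
  then have "x \<otimes> \<one> \<in> set_pow G U (n + d)"
    using assms by (blast intro: set_pow_addI)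
  then show "x \<in> set_pow G U (n + d)"
    using x set_pow_closed[OF assms(1)] by (metis r_one subsetD)
qed

lemma set_pow_increasing:
  assumes "U \<subseteq> carrier G" "\<one> \<in> U" "m \<le> n"
  shows "set_pow G U m \<subseteq> set_pow G U n"
  using assms(3)
proof (induction n rule: dec_induct)
  case (step n)
  then show ?case
    using set_pow_subset_add[of U 1 n] assms by (simp add: set_pow_1[simplified])
qed simp

lemma one_in_set_pow_mult:
  assumes "U \<subseteq> carrier G" "\<one> \<in> set_pow G U d"
  shows "\<one> \<in> set_pow G U (a * d)"
proof (induction a)
  case (Suc a)
  show ?case
    using set_pow_addI[OF assms(1) assms(2) Suc] by simp
qed simp

text \<open>Two consecutive integers generate all large integers under addition; so the identity is a
  product of exactly \<open>p\<close> elements of \<open>U\<close> for every large \<open>p\<close>.\<close>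

lemma one_in_all_large_set_pow:
  assumes U: "U \<subseteq> carrier G"
    and k: "\<one> \<in> set_pow G U k" "\<one> \<in> set_pow G U (k + 1)"
  obtains N where "\<And>p. p \<ge> N \<Longrightarrow> \<one> \<in> set_pow G U p"
proof
  fix p assume p: "k * k \<le> p"
  have comb: "\<one> \<in> set_pow G U (a * k + b * (k + 1))" for a b
    using set_pow_addI[OF U one_in_set_pow_mult[OF U k(1), of a]
        one_in_set_pow_mult[OF U k(2), of b]] by simp
  show "\<one> \<in> set_pow G U p"
  proof (cases "k = 0")
    case True
    then show ?thesis
      using comb[of 0 p] by simp
  next
    case False
    have "p mod k < k"
      using False by simp
    moreover have "k \<le> p div k"
      using p False by (simp add: less_eq_div_iff_mult_less_eq)
    ultimately have "p mod k \<le> p div k"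
      by simp
    \<comment> \<open>\<open>p = dk + r\<close> with \<open>r < k \<le> d\<close> equals \<open>(d - r)k + r(k + 1)\<close>.\<close>
    then have "(p div k - p mod k) * k + (p mod k) * (k + 1) = p"
      using div_mult_mod_eq[of p k] by (simp add: algebra_simps diff_mult_distrib2)
    then show ?thesis
      using comb by metis
  qed
qed

lemma set_pow_inv:
  assumes "W \<subseteq> carrier G" "\<And>w. w \<in> W \<Longrightarrow> inv w \<in> W" "w \<in> set_pow G W n"
  shows "inv w \<in> set_pow G W n"
  using assms(3)
proof (induction n arbitrary: w)
  case (Suc n)
  obtain x y where xy: "x \<in> set_pow G W n" "y \<in> set_pow G W 1" "w = x \<otimes> y"
    using set_pow_addE[OF assms(1) Suc.prems, of n 1] by auto
  then have "x \<in> carrier G" "y \<in> carrier G" "y \<in> W"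
    using set_pow_closed[OF assms(1)] set_pow_1[OF assms(1)] by blast+
  then have "inv w = inv y \<otimes> inv x" "inv y \<in> set_pow G W 1"
    using assms(2) set_pow_1[OF assms(1)] xy by (auto simp: inv_mult_group)
  then show ?case
    using set_pow_addI[OF assms(1) _ Suc.IH[OF xy(1)], of "inv y" 1] by simp
qed simp

text \<open>Without \<open>\<one> \<in> S\<close> the powers of \<open>S\<close> need not be increasing. Therefore the comparison is with the
  union of the powers up to a given exponent, which costs only one more factor of the exponent in
  measure.\<close>

lemma set_pow_subset_Union:
  assumes S: "S \<subseteq> carrier G" and W: "W \<subseteq> (\<Union>j\<le>m. set_pow G S j)"
  shows "set_pow G W n \<subseteq> (\<Union>j\<le>m * n. set_pow G S j)"
proof (induction n)
  case (Suc n)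
  show ?case
  proof
    fix x assume "x \<in> set_pow G W (Suc n)"
    then obtain y z where yz: "y \<in> set_pow G W n" "z \<in> W" "x = y \<otimes> z"
      by (auto simp: set_mult_def)
    obtain i j where ij: "i \<le> m * n" "j \<le> m" "y \<in> set_pow G S i" "z \<in> set_pow G S j"
      using yz Suc W by blast
    have "x \<in> set_pow G S (i + j)"
      using set_pow_addI[OF S ij(3,4)] yz by simp
    moreover have "i + j \<le> m * Suc n"
      using ij by simp
    ultimately show "x \<in> (\<Union>j\<le>m * Suc n. set_pow G S j)"
      by blast
  qed
qed simp

end

section \<open>Compact sets in a locally compact group\<close>

locale haar_group = topological_group G T
  for G :: "('a, 'b) monoid_scheme" (structure) and T :: "'a topology" +
  fixes \<mu> :: "'a measure"
  assumes Hausdorff: "Hausdorff_space T"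
    and locally_compact: "locally_compact_space T"
    and haar: "left_haar_measure G T \<mu>"
begin

lemma compactin_subset_carrier: "compactin T K \<Longrightarrow> K \<subseteq> carrier G"
  by (metis compactin_subset_topspace topspace_eq_carrier)

lemma compactin_set_mult:
  assumes "compactin T K" "compactin T L"
  shows "compactin T (K <#> L)"
proof -
  have "compactin T ((\<lambda>(x, y). x \<otimes> y) ` (K \<times> L))"
    using assms by (intro image_compactin[OF _ continuous_mult]) (simp add: compactin_Times)
  moreover have "(\<lambda>(x, y). x \<otimes> y) ` (K \<times> L) = K <#> L"
    by (auto simp: set_mult_def)
  ultimately show ?thesis
    by simp
qed

lemma compactin_one: "compactin T {\<one>}"
  by (simp add: topspace_eq_carrier)

lemma compactin_set_pow: "compactin T K \<Longrightarrow> compactin T (set_pow G K n)"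
  by (induction n) (use compactin_one in \<open>simp_all add: compactin_set_mult\<close>)

lemma compactin_l_coset:
  assumes "g \<in> carrier G" "compactin T K"
  shows "compactin T (g <# K)"
  using compactin_set_mult[of "{g}" K] assms
  by (simp add: l_coset_eq_set_mult topspace_eq_carrier)

lemma continuous_left_translation:
  assumes "g \<in> carrier G"
  shows "continuous_map T T (\<lambda>x. g \<otimes> x)"
proof -
  have "continuous_map T (prod_topology T T) (\<lambda>x. (g, x))"
    using assms by (simp add: continuous_map_pairedI topspace_eq_carrier)
  from continuous_map_compose[OF this continuous_mult] show ?thesis
    by (simp add: o_def)
qed

lemma openin_l_coset:
  assumes g: "g \<in> carrier G" and V: "openin T V"
  shows "openin T (g <# V)"
proof -
  have "openin T {x \<in> topspace T. inv g \<otimes> x \<in> V}"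
    using continuous_left_translation[of "inv g"] g V
    by (simp add: openin_continuous_map_preimage)
  moreover have "{x \<in> topspace T. inv g \<otimes> x \<in> V} = (g <# V)"
  proof (intro Set.set_eqI iffI)
    fix x assume "x \<in> {x \<in> topspace T. inv g \<otimes> x \<in> V}"
    then show "x \<in> g <# V"
      using g by (auto simp: l_coset_def topspace_eq_carrier m_assoc[symmetric]
          intro!: bexI[of _ "inv g \<otimes> x"])
  next
    fix x assume "x \<in> g <# V"
    then show "x \<in> {x \<in> topspace T. inv g \<otimes> x \<in> V}"
      using g openin_subset[OF V] 
      by (auto simp: l_coset_def topspace_eq_carrier m_assoc[symmetric])
  qed
  ultimately show ?thesis
    by simp
qed

text \<open>By Baire's theorem some power of \<open>S\<close> has nonempty interior. Since the inverse of an interior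
  point is itself a product of elements of \<open>S\<close>, translating this interior gives, around each point
  of the group, an open set inside a single power of \<open>S\<close>; compactness does the rest.\<close>

lemma compact_subset_Union_set_pow:
  assumes S: "compactin T S" and gen: "generating G S" and Q: "compactin T Q"
  obtains m where "Q \<subseteq> (\<Union>j\<le>m. set_pow G S j)"
proof -
  have SG: "S \<subseteq> carrier G" and UN: "(\<Union>n. set_pow G S n) = carrier G"
    using gen by (auto simp: generating_def)
  have "T interior_of \<Union>(range (set_pow G S)) \<noteq> {}"
    using UN topspace_eq_carrier one_closed by (metis empty_iff interior_of_topspace)
  then have "\<not> (\<forall>n. closedin T (set_pow G S n) \<and> T interior_of set_pow G S n = {})"
    using Baire_category_aux[OF locally_compact
        locally_compact_Hausdorff_imp_regular_space[OF locally_compact Hausdorff],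
        of "range (set_pow G S)"] by auto
  then obtain n O1 g where O1: "openin T O1" "O1 \<subseteq> set_pow G S n" and g: "g \<in> O1"
    using compactin_imp_closedin[OF Hausdorff compactin_set_pow[OF S]]
    by (metis all_not_in_conv interior_of_subset openin_interior_of)
  have gG: "g \<in> carrier G"
    using g O1 set_pow_closed[OF SG] by blast
  then obtain l where l: "inv g \<in> set_pow G S l"
    using UN by blast
  have cover: "\<exists>V j. openin T V \<and> x \<in> V \<and> V \<subseteq> set_pow G S j" if x: "x \<in> carrier G" for x
  proof -
    obtain i where i: "x \<in> set_pow G S i"
      using UN x by blast
    have "openin T ((x \<otimes> inv g) <# O1)"
      using O1 gG x by (intro openin_l_coset) auto
    moreover have "x \<in> (x \<otimes> inv g) <# O1"
      using g gG x by (auto simp: l_coset_def m_assoc intro!: bexI[of _ g])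
    moreover have "(x \<otimes> inv g) <# O1 \<subseteq> set_pow G S (i + l + n)"
      using set_pow_addI[OF SG set_pow_addI[OF SG i l refl] _ refl] O1
      by (auto simp: l_coset_def)
    ultimately show ?thesis
      by blast
  qed
  obtain V e where V: "\<And>x. x \<in> carrier G \<Longrightarrow> openin T (V x) \<and> x \<in> V x \<and> V x \<subseteq> set_pow G S (e x)"
    using cover by metis
  have QG: "Q \<subseteq> carrier G"
    using Q by (rule compactin_subset_carrier)
  have op: "\<And>A. A \<in> V ` Q \<Longrightarrow> openin T A"
    using V QG by blast
  have "Q \<subseteq> \<Union>(V ` Q)"
    using V QG by blast
  then have "\<exists>\<F>. finite \<F> \<and> \<F> \<subseteq> V ` Q \<and> Q \<subseteq> \<Union>\<F>"
    using Q op by (simp add: compactin_def)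
  then obtain \<F> where "finite \<F>" "\<F> \<subseteq> V ` Q" "Q \<subseteq> \<Union>\<F>"
    by meson
  then obtain Q0 where Q0: "Q0 \<subseteq> Q" "finite Q0" "Q \<subseteq> \<Union>(V ` Q0)"
    by (metis finite_subset_image)
  have "Q \<subseteq> (\<Union>j\<le>Max (e ` Q0). set_pow G S j)"
  proof
    fix x assume "x \<in> Q"
    then obtain y where y: "y \<in> Q0" "x \<in> V y"
      using Q0 by blast
    then have "x \<in> set_pow G S (e y)" "e y \<le> Max (e ` Q0)"
      using V[of y] Q0 QG by auto
    then show "x \<in> (\<Union>j\<le>Max (e ` Q0). set_pow G S j)"
      by blast
  qed
  then show thesis
    by (rule that)
qed

text \<open>Aperiodicity turns the union of powers into a single power: each \<open>S\<^sup>i\<close> lies in \<open>S\<^sup>j\<close> as soon as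
  \<open>j - i\<close> is large enough for \<open>\<one> \<in> S\<^bsup>j - i\<^esup>\<close>.\<close>

lemma compact_subset_set_pow:
  assumes S: "compactin T S" and gen: "generating G S" and Q: "compactin T Q"
    and k: "\<one> \<in> set_pow G S k" "\<one> \<in> set_pow G S (k + 1)"
  obtains q where "\<And>j. j \<ge> q \<Longrightarrow> Q \<subseteq> set_pow G S j"
proof -
  have SG: "S \<subseteq> carrier G"
    using gen by (auto simp: generating_def)
  obtain m where m: "Q \<subseteq> (\<Union>j\<le>m. set_pow G S j)"
    using compact_subset_Union_set_pow[OF S gen Q] .
  obtain N where N: "\<And>p. p \<ge> N \<Longrightarrow> \<one> \<in> set_pow G S p"
    using one_in_all_large_set_pow[OF SG k] by blast
  have "Q \<subseteq> set_pow G S j" if j: "j \<ge> m + N" for j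
  proof
    fix x assume "x \<in> Q"
    then obtain i where i: "i \<le> m" "x \<in> set_pow G S i"
      using m by blast
    then have "j - i \<ge> N" "i + (j - i) = j"
      using j by auto
    then show "x \<in> set_pow G S j"
      using set_pow_subset_add[OF SG N, of "j - i" i] i by auto
  qed
  then show thesis
    by (rule that)
qed

section \<open>Packing translates of a ball\<close>

lemma compactin_fmeasurable:
  assumes "compactin T K"
  shows "K \<in> fmeasurable \<mu>"
proof -
  have op: "openin T (carrier G - K)"
    using compactin_imp_closedin[OF Hausdorff assms]
    by (simp add: closedin_def topspace_eq_carrier)
  have sets: "sets \<mu> = sigma_sets (carrier G) {V. openin T V}" and sp: "space \<mu> = carrier G"
    using haar by (simp_all add: left_haar_measure_def)
  have "space \<mu> - (carrier G - K) \<in> sets \<mu>"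
    using op unfolding sets sp by (intro sigma_sets.Compl sigma_sets.Basic) simp
  then have "K \<in> sets \<mu>"
    using compactin_subset_carrier[OF assms] by (simp add: sp double_diff)
  moreover have "emeasure \<mu> K < \<infinity>"
    using haar assms by (auto simp: left_haar_measure_def)
  ultimately show ?thesis
    by (rule fmeasurableI)
qed

lemma measure_l_coset:
  assumes "g \<in> carrier G" "compactin T K"
  shows "measure \<mu> (g <# K) = measure \<mu> K"
  using haar assms compactin_fmeasurable[OF assms(2)]
  by (auto simp: left_haar_measure_def measure_def fmeasurable_def)

text \<open>Take a maximal family of disjoint translates of \<open>B\<close> inside \<open>E\<close>. There are at most
  \<open>\<mu> E / \<mu> B\<close> of them. For \<open>x \<in> X\<close>, the translate of \<open>B\<close> associated with \<open>x\<close> meets a member of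
  the family by maximality, so the corresponding translates of \<open>P\<close> cover \<open>X\<close>.\<close>

lemma measure_le_packing:
  assumes B: "compactin T B" "measure \<mu> B > 0" and P: "compactin T P"
    and X: "X \<in> fmeasurable \<mu>" and E: "E \<in> fmeasurable \<mu>"
    and cov: "\<And>x. x \<in> X \<Longrightarrow> \<exists>y\<in>carrier G. (y <# B) \<subseteq> E \<and>
               (\<forall>z\<in>carrier G. (y <# B) \<inter> (z <# B) \<noteq> {} \<longrightarrow> x \<in> z <# P)"
  shows "measure \<mu> X * measure \<mu> B \<le> measure \<mu> P * measure \<mu> E"
proof -
  define packing where "packing = (\<lambda>F. finite F \<and> F \<subseteq> carrier G \<and> (\<forall>y\<in>F. (y <# B) \<subseteq> E) \<and>
     disjoint_family_on (\<lambda>y. y <# B) F)"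
  have fm: "y <# K \<in> fmeasurable \<mu>" if "y \<in> carrier G" "compactin T K" for y K
    using that by (intro compactin_fmeasurable compactin_l_coset)
  have card_le: "real (card F) * measure \<mu> B \<le> measure \<mu> E" if F: "packing F" for F
  proof -
    have "measure \<mu> (\<Union>y\<in>F. y <# B) = (\<Sum>y\<in>F. measure \<mu> (y <# B))"
      using F fm[OF _ B(1)] unfolding packing_def
      by (intro measure_finite_Union) (auto simp: fmeasurable_def, metis subsetD less_irrefl)
    also have "\<dots> = (\<Sum>y\<in>F. measure \<mu> B)"
      using F B by (intro sum.cong) (auto simp: packing_def measure_l_coset)
    finally have "real (card F) * measure \<mu> B = measure \<mu> (\<Union>y\<in>F. y <# B)"
      by simp
    also have "\<dots> \<le> measure \<mu> E"
      using F E fm[OF _ B(1)] unfolding packing_def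
      by (intro measure_mono_fmeasurable sets.finite_UN) (auto simp: fmeasurable_def)
    finally show ?thesis .
  qed
  have "\<forall>F. packing F \<longrightarrow> card F < Suc (nat \<lfloor>measure \<mu> E / measure \<mu> B\<rfloor>)"
    using card_le B by (auto simp: le_nat_floor less_Suc_eq_le pos_le_divide_eq)
  moreover have "packing {}"
    by (simp add: packing_def disjoint_family_on_def)
  ultimately obtain F where F: "packing F" and max: "\<And>F'. packing F' \<Longrightarrow> card F' \<le> card F"
    using ex_has_greatest_nat[of packing "{}" card] by blast
  have "X \<subseteq> (\<Union>z\<in>F. z <# P)"
  proof
    fix x assume x: "x \<in> X"
    obtain y where y: "y \<in> carrier G" "(y <# B) \<subseteq> E"
      and meet: "\<And>z. z \<in> carrier G \<Longrightarrow> (y <# B) \<inter> (z <# B) \<noteq> {} \<Longrightarrow> x \<in> z <# P"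
      using cov[OF x] by (elim bexE conjE) (rule that, auto)
    have "\<exists>z\<in>F. (y <# B) \<inter> (z <# B) \<noteq> {}"
    proof (rule ccontr)
      assume *: "\<not> ?thesis"
      have "B \<noteq> {}"
        using B by auto
      then have "(y <# B) \<noteq> {}"
        by (auto simp: l_coset_def)
      then have "y \<notin> F"
        using * by blast
      have "(y <# B) \<inter> (\<Union>z\<in>F. z <# B) = {}"
        using * by blast
      then have "disjoint_family_on (\<lambda>y. y <# B) (insert y F)"
        using F disjoint_family_on_insert[OF \<open>y \<notin> F\<close>, of "\<lambda>y. y <# B"]
        by (simp only: packing_def simp_thms)
      then have "packing (insert y F)"
        using F y by (simp add: packing_def)
      then show False
        using max[of "insert y F"] F \<open>y \<notin> F\<close> by (simp add: packing_def)
    qed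
    then show "x \<in> (\<Union>z\<in>F. z <# P)"
      using meet F unfolding packing_def by blast
  qed
  then have "measure \<mu> X \<le> measure \<mu> (\<Union>z\<in>F. z <# P)"
    using F fm[OF _ P] X unfolding packing_def
    by (intro measure_mono_fmeasurable fmeasurable.finite_UN) (auto simp: fmeasurable_def)
  also have "\<dots> \<le> (\<Sum>z\<in>F. measure \<mu> (z <# P))"
    using F fm[OF _ P] by (intro measure_UNION_le) (auto simp: packing_def fmeasurable_def)
  also have "\<dots> = (\<Sum>z\<in>F. measure \<mu> P)"
    using F P by (intro sum.cong) (auto simp: packing_def measure_l_coset)
  finally have "measure \<mu> X * measure \<mu> B \<le> real (card F) * measure \<mu> P * measure \<mu> B"
    using B by (intro mult_right_mono) auto
  also have "\<dots> \<le> measure \<mu> P * measure \<mu> E"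
    using mult_left_mono[OF card_le[OF F], of "measure \<mu> P"] by (simp add: mult_ac)
  finally show ?thesis .
qed


lemma measure_Diff_add:
  assumes "compactin T A" "compactin T B" "compactin T C" "C \<subseteq> B" "B \<subseteq> A"
  shows "measure \<mu> (A - B) + measure \<mu> (B - C) = measure \<mu> (A - C)"
proof -
  have "A \<in> fmeasurable \<mu>" "B \<in> fmeasurable \<mu>" "C \<in> fmeasurable \<mu>"
    using assms by (auto intro: compactin_fmeasurable)
  then have "measure \<mu> (A - B) = measure \<mu> A - measure \<mu> B"
    "measure \<mu> (B - C) = measure \<mu> B - measure \<mu> C"
    "measure \<mu> (A - C) = measure \<mu> A - measure \<mu> C"
    using assms by (auto intro!: measurable_measure_Diff)
  then show ?thesis
    by simp
qed

text \<open>The geometric heart of the argument. Split \<open>x = y z\<close> with \<open>z \<in> U\<^bsup>t + q t\<^esup>\<close>. The ball \<open>y W\<^sup>t\<close> stays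
  in \<open>U\<^bsup>n - t\<^esup>\<close> because \<open>W\<^sup>t \<subseteq> U\<^bsup>q t\<^esup>\<close>. If it met \<open>U\<^bsup>n - (2 q + 3) t\<^esup>\<close>, then going back to \<open>y\<close>
  would cost \<open>q t\<close> factors and going on to \<open>x\<close> would cost \<open>t + q t\<close>, so that
  \<open>x \<in> U\<^bsup>n - 2 t\<^esup> \<subseteq> U\<^bsup>n - t\<^esup>\<close>, where \<open>t \<ge> q\<close> gives the inclusion. The same \<open>(2 q + 3) t\<close> serves as
  radius of the covering balls: if \<open>y W\<^sup>t\<close> meets \<open>z' W\<^sup>t\<close>, then \<open>x\<close> is at distance at most
  \<open>2 t + (t + q t)\<close> from \<open>z'\<close>.\<close>

lemma annulus_packing:
  assumes U: "compactin T U" and W: "compactin T W" and UW: "U \<subseteq> W"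
    and one: "\<one> \<in> W" and inv: "\<And>w. w \<in> W \<Longrightarrow> inv w \<in> W"
    and q: "\<And>j. j \<ge> q \<Longrightarrow> W \<subseteq> set_pow G U j" and t: "q \<le> t" "(2 * q + 3) * t \<le> n"
    and pos: "measure \<mu> (set_pow G W t) > 0"
  shows "measure \<mu> (set_pow G U n - set_pow G U (n - t)) * measure \<mu> (set_pow G W t)
       \<le> measure \<mu> (set_pow G W ((2 * q + 3) * t)) *
          measure \<mu> (set_pow G U (n - t) - set_pow G U (n - (2 * q + 3) * t))"
proof (rule measure_le_packing)
  define a where "a = q * t"
  have Mt: "(2 * q + 3) * t = 2 * a + 3 * t"
    by (simp add: a_def algebra_simps)
  have UG: "U \<subseteq> carrier G" and WG: "W \<subseteq> carrier G"
    using U W by (auto dest: compactin_subset_carrier)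
  have Wt: "set_pow G W t \<subseteq> set_pow G U a"
    using set_pow_mono[OF q[OF order_refl], of t] set_pow_mult[OF UG, of q t]
    by (simp add: a_def)
  have WtG: "set_pow G W t \<subseteq> carrier G"
    by (rule set_pow_closed[OF WG])
  fix x assume x: "x \<in> set_pow G U n - set_pow G U (n - t)"
  have n_split: "n = (n - t - a) + (t + a)"
    using t unfolding Mt by simp
  obtain y z where y: "y \<in> set_pow G U (n - t - a)" and z: "z \<in> set_pow G U (t + a)"
    and xyz: "x = y \<otimes> z"
    using set_pow_addE[OF UG _ n_split, of x] x by blast
  have yG: "y \<in> carrier G" and zG: "z \<in> carrier G"
    using y z set_pow_closed[OF UG] by blast+
  show "\<exists>y\<in>carrier G.
      (y <# set_pow G W t) \<subseteq> set_pow G U (n - t) - set_pow G U (n - (2 * q + 3) * t) \<and>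
      (\<forall>z\<in>carrier G. (y <# set_pow G W t) \<inter> (z <# set_pow G W t) \<noteq> {} \<longrightarrow>
          x \<in> z <# set_pow G W ((2 * q + 3) * t))"
  proof (intro bexI conjI ballI impI subsetI DiffI)
    fix u assume "u \<in> y <# set_pow G W t"
    then obtain w where w: "w \<in> set_pow G W t" "u = y \<otimes> w"
      by (auto simp: l_coset_def)
    then have wG: "w \<in> carrier G"
      using WtG by blast
    show "u \<in> set_pow G U (n - t)"
      unfolding w(2)
      by (rule set_pow_addI[OF UG y]) (use Wt w t in \<open>auto simp: Mt\<close>)
    show "u \<notin> set_pow G U (n - (2 * q + 3) * t)"
    proof
      assume u: "u \<in> set_pow G U (n - (2 * q + 3) * t)"
      have "inv w \<in> set_pow G U a"
        using set_pow_inv[OF WG inv w(1)] Wt by blast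
      from set_pow_addI[OF UG set_pow_addI[OF UG u this refl] z refl]
      have "u \<otimes> inv w \<otimes> z \<in> set_pow G U (n - (2 * q + 3) * t + a + (t + a))" .
      moreover have "u \<otimes> inv w \<otimes> z = x"
        using w wG yG zG by (simp add: xyz m_assoc)
      moreover have "n - (2 * q + 3) * t + a + (t + a) = n - 2 * t"
        using t unfolding Mt by simp
      ultimately have "x \<in> set_pow G U (n - 2 * t)"
        by simp
      moreover have "set_pow G U (n - 2 * t) \<subseteq> set_pow G U (n - 2 * t + t)"
        using q[OF t(1)] one by (intro set_pow_subset_add[OF UG]) blast
      moreover have "n - 2 * t + t = n - t"
        using t unfolding Mt by simp
      ultimately show False
        using x by auto
    qed
  next
    fix z' assume z'G: "z' \<in> carrier G"
      and meet: "(y <# set_pow G W t) \<inter> (z' <# set_pow G W t) \<noteq> {}"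
    then obtain w w' where w: "w \<in> set_pow G W t" and w': "w' \<in> set_pow G W t"
      and eq: "y \<otimes> w = z' \<otimes> w'"
      by (auto simp: l_coset_def)
    have wG: "w \<in> carrier G" "w' \<in> carrier G"
      using w w' WtG by blast+
    have "y = z' \<otimes> w' \<otimes> inv w"
      using eq wG yG z'G by (metis inv_solve_right m_closed)
    then have x_eq: "x = z' \<otimes> (w' \<otimes> inv w \<otimes> z)"
      using wG z'G zG by (simp add: xyz m_assoc)
    have "z \<in> set_pow G W (t + a)"
      using z set_pow_mono[OF UW] by blast
    from set_pow_addI[OF WG set_pow_addI[OF WG w' set_pow_inv[OF WG inv w] refl] this refl]
    have "w' \<otimes> inv w \<otimes> z \<in> set_pow G W (t + t + (t + a))" .
    moreover have "set_pow G W (t + t + (t + a)) \<subseteq> set_pow G W ((2 * q + 3) * t)"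
      by (rule set_pow_increasing[OF WG one]) (simp add: Mt)
    ultimately show "x \<in> z' <# set_pow G W ((2 * q + 3) * t)"
      unfolding x_eq l_coset_def by blast
  qed (rule yG)
qed (use pos U W in \<open>auto intro: compactin_set_pow fmeasurable_Diff
       compactin_fmeasurable[OF compactin_set_pow]
       fmeasurableD[OF compactin_fmeasurable[OF compactin_set_pow]]\<close>)

section \<open>Transfer of polynomial growth\<close>

text \<open>Polynomial growth is assumed for some compact generating set \<open>V\<close>. It passes to \<open>W\<close> because \<open>W\<close> lies
  in a union of finitely many powers of \<open>V\<close>. Summing the measures of the powers of \<open>V\<close> up to \<open>m n\<close> raises the
  degree by one.\<close>

lemma polynomial_growth_compact:
  assumes growth: "polynomial_growth G T \<mu>" and W: "compactin T W"
  obtains C D :: real where "C > 0" "D > 0"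
    "\<And>n. n \<ge> 1 \<Longrightarrow> measure \<mu> (set_pow G W n) \<le> C * real n powr D"
proof -
  obtain V D C0 where V: "compactin T V" "generating G V" and D: "D > 0" and C0: "C0 \<ge> 1"
    and em: "\<And>n. n \<ge> 1 \<Longrightarrow> emeasure \<mu> (set_pow G V n) \<le> ennreal (C0 * real n powr D)"
    using growth by (auto simp: polynomial_growth_def)
  have VG: "V \<subseteq> carrier G"
    using V by (simp add: generating_def)
  have fm: "set_pow G K n \<in> fmeasurable \<mu>" if "compactin T K" for K n
    using that by (intro compactin_fmeasurable compactin_set_pow)
  obtain m0 where m0: "W \<subseteq> (\<Union>j\<le>m0. set_pow G V j)"
    using compact_subset_Union_set_pow[OF V W] .
  define m where "m = m0 + 1"
  have m: "W \<subseteq> (\<Union>j\<le>m. set_pow G V j)" "m \<ge> 1"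
    using m0 by (fastforce simp: m_def)+
  \<comment> \<open>The growth condition says nothing about the power \<open>V\<^sup>0 = {\<one>}\<close>, so its measure is added.\<close>
  define c where "c = C0 + measure \<mu> {\<one>}"
  have c: "c > 0"
    using C0 by (simp add: c_def add_pos_nonneg)
  have V_le: "measure \<mu> (set_pow G V j) \<le> c * real k powr D" if "j \<le> k" "1 \<le> k" for j k
  proof (cases "j = 0")
    case True
    have "1 \<le> real k powr D"
      using that D by (simp add: ge_one_powr_ge_zero)
    moreover have "measure \<mu> {\<one>} \<le> c"
      using C0 by (simp add: c_def)
    ultimately show ?thesis
      using c True mult_mono[of "measure \<mu> {\<one>}" c 1 "real k powr D"] by simp
  next
    case False
    have "ennreal (measure \<mu> (set_pow G V j)) \<le> ennreal (C0 * real j powr D)"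
      using em[of j] False fm[OF V(1)] by (simp add: emeasure_eq_measure2)
    then have "measure \<mu> (set_pow G V j) \<le> C0 * real j powr D"
      using C0 by (simp add: ennreal_le_iff)
    also have "\<dots> \<le> c * real k powr D"
      using that D C0 by (intro mult_mono powr_mono2) (auto simp: c_def)
    finally show ?thesis .
  qed
  have "measure \<mu> (set_pow G W n) \<le> (2 * c * real m powr (D + 1)) * real n powr (D + 1)"
    if n: "n \<ge> 1" for n
  proof -
    have mn: "1 \<le> m * n"
      using m n by simp
    have "measure \<mu> (set_pow G W n) \<le> measure \<mu> (\<Union>j\<le>m * n. set_pow G V j)"
      using fm[OF V(1)] fm[OF W]
      by (intro measure_mono_fmeasurable set_pow_subset_Union[OF VG m(1)] fmeasurable.finite_UN)
        (auto intro: fmeasurableD)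
    also have "\<dots> \<le> (\<Sum>j\<le>m * n. measure \<mu> (set_pow G V j))"
      using fm[OF V(1)] by (intro measure_UNION_le) (auto intro: fmeasurableD)
    also have "\<dots> \<le> (\<Sum>j\<le>m * n. c * real (m * n) powr D)"
      by (intro sum_mono V_le) (use mn in auto)
    also have "\<dots> = (real (m * n) + 1) * (c * real (m * n) powr D)"
      by simp
    also have "\<dots> \<le> (2 * real (m * n)) * (c * real (m * n) powr D)"
      using mn c by (intro mult_right_mono) (auto simp del: of_nat_mult)
    also have "\<dots> = 2 * c * real (m * n) powr (D + 1)"
      using mn by (simp add: powr_add del: of_nat_mult)
    also have "\<dots> = (2 * c * real m powr (D + 1)) * real n powr (D + 1)"
      by (simp add: powr_mult)
    finally show ?thesis .
  qed
  moreover have "2 * c * real m powr (D + 1) > 0" "D + 1 > 0"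
    using c m D by auto
  ultimately show thesis
    using that by blast
qed

end

section \<open>Iteration over scales\<close>

text \<open>A lower bound for \<open>ln (1 + 1 / K)\<close> that is affine in \<open>ln K\<close>, so that it can be summed over scales
  when only the product of the values of \<open>K\<close> is controlled. The threshold \<open>\<kappa>\<close> separates good scales
  \<open>K \<le> \<kappa>\<close> from bad ones, where the exponential is at most \<open>1\<close>.\<close>

lemma one_plus_inverse_ge_exp:
  fixes K \<kappa> :: real
  assumes K: "K \<ge> 1" and \<kappa>: "\<kappa> > 1"
  shows "exp (ln (1 + 1 / \<kappa>) * (1 - ln K / ln \<kappa>)) \<le> 1 + 1 / K"
proof (cases "K \<le> \<kappa>")
  case True
  have c: "ln (1 + 1 / \<kappa>) \<ge> 0"
    using \<kappa> by simp
  have "ln K / ln \<kappa> \<ge> 0"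
    using K \<kappa> by simp
  then have "ln (1 + 1 / \<kappa>) * (1 - ln K / ln \<kappa>) \<le> ln (1 + 1 / \<kappa>) * 1"
    using c by (intro mult_left_mono) auto
  then have "exp (ln (1 + 1 / \<kappa>) * (1 - ln K / ln \<kappa>)) \<le> exp (ln (1 + 1 / \<kappa>))"
    by simp
  also have "\<dots> = 1 + 1 / \<kappa>"
    using \<kappa> by (simp add: add_pos_pos)
  also have "\<dots> \<le> 1 + 1 / K"
    using True K by (simp add: frac_le)
  finally show ?thesis .
next
  case False
  have "ln K / ln \<kappa> \<ge> 1"
    using False \<kappa> by simp
  then have "ln (1 + 1 / \<kappa>) * (1 - ln K / ln \<kappa>) \<le> 0"
    using \<kappa> by (intro mult_nonneg_nonpos) auto
  then have "exp (ln (1 + 1 / \<kappa>) * (1 - ln K / ln \<kappa>)) \<le> 1"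
    by simp
  also have "1 \<le> 1 + 1 / K"
    using K by simp
  finally show ?thesis .
qed

text \<open>Iterating the growth step along \<open>t = M\<^sup>i t\<^sub>0\<close>, the ratios \<open>K = v (M t) / v t\<close> multiply to
  \<open>v (M\<^sup>i t\<^sub>0) / v t\<^sub>0\<close>, which is at most a constant times \<open>M\<^bsup>i D\<^esup>\<close>. With \<open>\<kappa> = M\<^bsup>2 D\<^esup>\<close> the bad scales
  consume at most half of the gain, so \<open>F n\<close> grows at least like \<open>exp (c i / 2)\<close>. The number \<open>i\<close> of
  scales is about \<open>ln (n / t\<^sub>0) / ln M\<close>, which makes this a positive power of \<open>n\<close>.\<close>

lemma polynomial_decay_by_scales:
  fixes F :: "nat \<Rightarrow> nat \<Rightarrow> real" and a v :: "nat \<Rightarrow> real" and C D :: real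
  assumes M: "M \<ge> 2" and t0: "t0 \<ge> 1" and D: "D > 0" and C: "C > 0"
    and F_nonneg: "\<And>n t. 0 \<le> F n t" and F_le: "\<And>n t. F n t \<le> a n"
    and v_pos: "\<And>t. t \<ge> t0 \<Longrightarrow> v t > 0"
    and v_incr: "\<And>t. t \<ge> t0 \<Longrightarrow> v t \<le> v (M * t)"
    and v_le: "\<And>t. t \<ge> t0 \<Longrightarrow> v t \<le> C * real t powr D"
    and step: "\<And>n t. t \<ge> t0 \<Longrightarrow> M * t \<le> n \<Longrightarrow> F n t * (1 + v t / v (M * t)) \<le> F n (M * t)"
  obtains \<delta> C' where "\<delta> > 0" "C' > 0"
    "\<And>n. n \<ge> t0 \<Longrightarrow> F n t0 \<le> C' * real n powr (- \<delta>) * a n"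
proof -
  define \<kappa> where "\<kappa> = real M powr (2 * D)"
  define c where "c = ln (1 + 1 / \<kappa>)"
  define w where "w = (\<lambda>i. v (M ^ i * t0))"
  have \<kappa>: "\<kappa> > 1"
    using M D by (simp add: \<kappa>_def)
  have ln_\<kappa>: "ln \<kappa> = 2 * D * ln (real M)"
    using M by (simp add: \<kappa>_def ln_powr)
  have ln_\<kappa>_pos: "ln \<kappa> > 0"
    using \<kappa> by simp
  have c: "c > 0"
    unfolding c_def using \<kappa> by (intro ln_gt_zero) simp
  have lnM: "ln (real M) > 0"
    using M by simp
  have scale: "M ^ i * t0 \<ge> t0" for i
    using M by simp
  have w_pos: "w i > 0" for i
    using v_pos[OF scale] by (simp add: w_def)
  have iter: "F n t0 * exp (c * (real i - ln (w i / w 0) / ln \<kappa>)) \<le> F n (M ^ i * t0)"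
    if "M ^ i * t0 \<le> n" for i n
    using that
  proof (induction i)
    case 0
    then show ?case
      using w_pos[of 0] by simp
  next
    case (Suc i)
    have "M ^ i * t0 \<le> M ^ Suc i * t0"
      using M by simp
    then have IH: "F n t0 * exp (c * (real i - ln (w i / w 0) / ln \<kappa>)) \<le> F n (M ^ i * t0)"
      using Suc by linarith
    define K where "K = w (Suc i) / w i"
    have K: "K \<ge> 1"
      using v_incr[OF scale[of i]] w_pos[of i] by (simp add: K_def w_def mult.assoc)
    have "ln (w (Suc i) / w 0) = ln (w i / w 0) + ln K"
      using w_pos[of 0] w_pos[of i] w_pos[of "Suc i"] by (simp add: K_def ln_div)
    then have "exp (c * (real (Suc i) - ln (w (Suc i) / w 0) / ln \<kappa>))
        = exp (c * (real i - ln (w i / w 0) / ln \<kappa>)) * exp (c * (1 - ln K / ln \<kappa>))"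
      by (simp add: exp_add[symmetric] algebra_simps add_divide_distrib)
    then have "F n t0 * exp (c * (real (Suc i) - ln (w (Suc i) / w 0) / ln \<kappa>))
        = F n t0 * exp (c * (real i - ln (w i / w 0) / ln \<kappa>)) * exp (c * (1 - ln K / ln \<kappa>))"
      by simp
    also have "\<dots> \<le> F n (M ^ i * t0) * (1 + 1 / K)"
      using IH one_plus_inverse_ge_exp[OF K \<kappa>] F_nonneg
      by (intro mult_mono) (auto simp: c_def)
    also have "\<dots> = F n (M ^ i * t0) * (1 + v (M ^ i * t0) / v (M * (M ^ i * t0)))"
      by (simp add: K_def w_def mult.assoc)
    also have "\<dots> \<le> F n (M ^ Suc i * t0)"
      using step[OF scale[of i], of n] Suc.prems by (simp add: mult.assoc)
    finally show ?case .
  qed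
  \<comment> \<open>\<open>b\<close> is the loss at the initial scale: below, \<open>ln (w i / w 0) / ln \<kappa> \<le> b + i / 2\<close>.\<close>
  define b where "b = ln (C * real t0 powr D / w 0) / ln \<kappa>"
  define \<delta> where "\<delta> = c / (2 * ln (real M))"
  define C' where "C' = exp (c * b + c / 2 + \<delta> * ln (real t0))"
  show thesis
  proof
    show "\<delta> > 0"
      using c lnM by (simp add: \<delta>_def)
    show "C' > 0"
      by (simp add: C'_def)
    fix n :: nat assume n: "n \<ge> t0"
    \<comment> \<open>\<open>i\<close> is the number of scales that fit below \<open>n\<close>.\<close>
    have "1 \<le> n div t0"
      using n t0 by (simp add: Suc_le_eq div_greater_zero_iff)
    then obtain i where i: "M ^ i \<le> n div t0" "n div t0 < M ^ (i + 1)"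
      using ex_power_ivl1[OF M] by blast
    have le: "M ^ i * t0 \<le> n"
      using i(1) t0 by (simp add: less_eq_div_iff_mult_less_eq)
    have less: "n < M ^ (i + 1) * t0"
      using i(2) t0 by (simp add: div_less_iff_less_mult)
    have ln_scale: "ln (real (M ^ i * t0)) = ln (real t0) + real i * ln (real M)"
      using M t0 by (simp add: ln_mult ln_realpow)
    have "w i \<le> C * real (M ^ i * t0) powr D"
      unfolding w_def by (rule v_le[OF scale])
    also have "\<dots> = C * real t0 powr D * exp (real i * (D * ln (real M)))"
      using M t0 ln_scale
      by (simp add: powr_def distrib_left exp_add mult_ac del: of_nat_mult of_nat_power)
    finally have "w i / w 0 \<le> C * real t0 powr D / w 0 * exp (real i * (D * ln (real M)))"
      using w_pos[of 0] by (simp add: divide_right_mono)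
    then have "ln (w i / w 0) \<le> ln (C * real t0 powr D / w 0 * exp (real i * (D * ln (real M))))"
      using w_pos[of 0] w_pos[of i] by (intro ln_mono) auto
    also have "\<dots> = ln (C * real t0 powr D / w 0) + real i * (D * ln (real M))"
      using w_pos[of 0] C t0 by (subst ln_mult) auto
    finally have "ln (w i / w 0) / ln \<kappa> \<le> (ln (C * real t0 powr D / w 0) + real i * (D * ln (real M))) / ln \<kappa>"
      using ln_\<kappa>_pos by (intro divide_right_mono) auto
    also have "\<dots> = b + real i / 2"
      using ln_\<kappa> lnM D by (simp add: b_def add_divide_distrib)
    finally have "c * (real i / 2 - b) \<le> c * (real i - ln (w i / w 0) / ln \<kappa>)"
      using c by (intro mult_left_mono) auto
    then have "F n t0 * exp (c * (real i / 2 - b)) \<le> F n t0 * exp (c * (real i - ln (w i / w 0) / ln \<kappa>))"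
      using F_nonneg by (intro mult_left_mono) auto
    also have "\<dots> \<le> a n"
      using iter[OF le] F_le order_trans by blast
    finally have "F n t0 * exp (c * (real i / 2 - b)) \<le> a n" .
    then have "F n t0 * exp (c * (real i / 2 - b)) * exp (c * (b - real i / 2))
        \<le> a n * exp (c * (b - real i / 2))"
      by (intro mult_right_mono) auto
    moreover have "exp (c * (real i / 2 - b)) * exp (c * (b - real i / 2)) = 1"
      by (simp add: exp_add[symmetric] algebra_simps)
    ultimately have 1: "F n t0 \<le> exp (c * (b - real i / 2)) * a n"
      by (simp only: mult.assoc mult_1_right mult.commute[of "a n"])
    have "real n \<le> real (M ^ (i + 1) * t0)"
      using less by linarith
    then have "ln (real n) \<le> ln (real (M ^ (i + 1) * t0))"
      using n t0 by (intro ln_mono) auto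
    also have "\<dots> = (real i + 1) * ln (real M) + ln (real t0)"
      using M t0 by (simp add: ln_mult ln_realpow algebra_simps)
    finally have "\<delta> * ln (real n) \<le> \<delta> * ((real i + 1) * ln (real M) + ln (real t0))"
      using \<open>\<delta> > 0\<close> by (intro mult_left_mono) auto
    also have "\<dots> = c / 2 * (real i + 1) + \<delta> * ln (real t0)"
      using lnM by (simp add: \<delta>_def field_simps)
    finally have "c * (b - real i / 2) \<le> c * b + c / 2 + \<delta> * ln (real t0) - \<delta> * ln (real n)"
      by (simp add: algebra_simps add_divide_distrib)
    then have "exp (c * (b - real i / 2)) \<le> C' * real n powr (- \<delta>)"
      using n t0 by (simp add: C'_def powr_def exp_add[symmetric])
    moreover have "0 \<le> a n"
      using F_nonneg[of n t0] F_le[of n t0] by linarith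
    ultimately show "F n t0 \<le> C' * real n powr (- \<delta>) * a n"
      using 1 by (meson mult_right_mono order_trans)
  qed
qed

section \<open>Powers of a generating set\<close>

locale haar_growth = haar_group +
  fixes U :: "'a set"
  assumes growth: "polynomial_growth G T \<mu>"
    and compact: "compactin T U"
    and generates: "generating G U"
    and aperiodic: "\<exists>k. \<one> \<in> set_pow G U k \<and> \<one> \<in> set_pow G U (k + 1)"
begin

lemma U_subset_carrier: "U \<subseteq> carrier G"
  using generates by (simp add: generating_def)

lemma compactin_U_pow: "compactin T (set_pow G U n)"
  using compact by (rule compactin_set_pow)

lemma U_pow_fmeasurable: "set_pow G U n \<in> fmeasurable \<mu>"
  by (rule compactin_fmeasurable[OF compactin_U_pow])

lemma eventually_contains_compact:
  assumes "compactin T Q"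
  obtains q where "\<And>j. j \<ge> q \<Longrightarrow> Q \<subseteq> set_pow G U j"
  using compact_subset_set_pow[OF compact generates assms] aperiodic by blast

lemma symmetric_compact_generating_superset:
  obtains W where "compactin T W" "U \<subseteq> W" "\<one> \<in> W" "\<And>w. w \<in> W \<Longrightarrow> inv w \<in> W"
proof
  show "compactin T (insert \<one> (U \<union> (\<lambda>x. inv x) ` U))"
    using compactin_Un[OF compactin_one compactin_Un[OF compact
          image_compactin[OF compact continuous_inv]]] by simp
qed (use U_subset_carrier in auto)

text \<open>The powers of \<open>W\<close> are countably many sets that cover a space of nonzero measure.\<close>

lemma exists_pow_positive_measure:
  assumes W: "compactin T W" "U \<subseteq> W"
  obtains n where "measure \<mu> (set_pow G W n) > 0"
proof -
  have WG: "W \<subseteq> carrier G"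
    using W by (intro compactin_subset_carrier)
  have fm: "set_pow G W n \<in> fmeasurable \<mu>" for n
    by (intro compactin_fmeasurable compactin_set_pow W)
  have "(\<Union>n. set_pow G W n) = carrier G"
    using generates set_pow_mono[OF W(2)] set_pow_closed[OF WG] unfolding generating_def by blast
  moreover have "emeasure \<mu> (carrier G) \<noteq> 0"
    using haar unfolding left_haar_measure_def by metis
  ultimately obtain n where "emeasure \<mu> (set_pow G W n) \<noteq> 0"
    using emeasure_UN_eq_0[of \<mu> "set_pow G W"] fm by (auto dest: fmeasurableD)
  then have "measure \<mu> (set_pow G W n) > 0"
    using fm[of n] by (simp add: emeasure_eq_measure2 zero_less_measure_iff)
  then show thesis
    by (rule that)
qed

text \<open>The width \<open>s\<close> is arbitrary because the iteration may start at any scale \<open>t\<^sub>0\<close>: it is chosen so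
  large that the annulus of width \<open>t\<^sub>0\<close> contains the one of width \<open>s\<close>, and that the balls \<open>W\<^sup>t\<close> with
  \<open>t \<ge> t\<^sub>0\<close> have positive measure.\<close>

lemma annulus_decay:
  obtains \<delta> C N where "\<delta> > 0" "C > 0"
    "\<And>n. n \<ge> N \<Longrightarrow> measure \<mu> (set_pow G U n - set_pow G U (n - s))
        \<le> C * real n powr (- \<delta>) * measure \<mu> (set_pow G U n)"
proof -
  obtain W where W: "compactin T W" "U \<subseteq> W" "\<one> \<in> W" "\<And>w. w \<in> W \<Longrightarrow> inv w \<in> W"
    using symmetric_compact_generating_superset by blast
  have WG: "W \<subseteq> carrier G"
    using W by (intro compactin_subset_carrier)
  have Wfm: "set_pow G W n \<in> fmeasurable \<mu>" for n
    by (intro compactin_fmeasurable compactin_set_pow W)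
  obtain q where q: "\<And>j. j \<ge> q \<Longrightarrow> W \<subseteq> set_pow G U j"
    using eventually_contains_compact[OF W(1)] by blast
  obtain k where k: "measure \<mu> (set_pow G W k) > 0"
    using exists_pow_positive_measure[OF W(1,2)] by blast
  obtain C D where C: "C > 0" "D > 0"
    and poly: "\<And>n. n \<ge> 1 \<Longrightarrow> measure \<mu> (set_pow G W n) \<le> C * real n powr D"
    using polynomial_growth_compact[OF growth W(1)] by blast
  define M where "M = 2 * q + 3"
  define t0 where "t0 = q + s + k + 1"
  define F where "F = (\<lambda>n t. measure \<mu> (set_pow G U n - set_pow G U (n - t)))"
  define v where "v = (\<lambda>t. measure \<mu> (set_pow G W t))"
  have v_mono: "v t \<le> v t'" if "t \<le> t'" for t t'
    unfolding v_def using Wfm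
    by (intro measure_mono_fmeasurable set_pow_increasing[OF WG W(3) that]) (auto intro: fmeasurableD)
  have v_pos: "v t > 0" if "t \<ge> t0" for t
    using k v_mono[of k t] that by (simp add: v_def t0_def)
  have U_sub: "set_pow G U m \<subseteq> set_pow G U n" if "m + q \<le> n" for m n
  proof -
    have "\<one> \<in> set_pow G U (n - m)"
      using q[of "n - m", THEN subsetD, OF _ W(3)] that by simp
    then show ?thesis
      using set_pow_subset_add[OF U_subset_carrier, of "n - m" m] that by simp
  qed
  have step: "F n t * (1 + v t / v (M * t)) \<le> F n (M * t)" if t: "t \<ge> t0" "M * t \<le> n" for n t
  proof -
    have tq: "q \<le> t"
      using t by (simp add: t0_def)
    have Mt: "2 * t + q \<le> M * t" "2 * t + q \<le> n" "q \<le> t"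
      using tq t(2) by (auto simp: M_def algebra_simps intro: order_trans)
    have pos: "v t > 0" "v (M * t) > 0"
      using v_pos t Mt by auto
    have "F n t * v t \<le> v (M * t) *
        measure \<mu> (set_pow G U (n - t) - set_pow G U (n - M * t))"
      using annulus_packing[OF compact W(1,2,3,4) q tq _ pos(1)[unfolded v_def], of n] t
      by (simp add: F_def v_def M_def)
    then have "F n t * (v t / v (M * t)) \<le>
        measure \<mu> (set_pow G U (n - t) - set_pow G U (n - M * t))"
      using pos by (simp add: field_simps)
    moreover have "F n t + measure \<mu> (set_pow G U (n - t) - set_pow G U (n - M * t)) = F n (M * t)"
      unfolding F_def using Mt t
      by (intro measure_Diff_add compactin_U_pow U_sub) auto
    ultimately show ?thesis
      by (simp add: distrib_left)
  qed
  obtain \<delta> C' where \<delta>: "\<delta> > 0" "C' > 0"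
    and decay: "\<And>n. n \<ge> t0 \<Longrightarrow> F n t0 \<le> C' * real n powr (- \<delta>) * measure \<mu> (set_pow G U n)"
  proof (rule polynomial_decay_by_scales[where M = M and ?t0.0 = t0 and D = D and C = C and F = F
        and v = v and a = "\<lambda>n. measure \<mu> (set_pow G U n)"])
    show "F n t \<le> measure \<mu> (set_pow G U n)" for n t
      unfolding F_def using U_pow_fmeasurable
      by (intro measure_mono_fmeasurable) (auto intro: fmeasurableD)
    show "v t \<le> v (M * t)" for t
      by (rule v_mono) (simp add: M_def)
    show "v t \<le> C * real t powr D" if "t \<ge> t0" for t
      using poly[of t] that by (simp add: v_def t0_def)
  qed (use C v_pos step in \<open>auto simp: M_def t0_def F_def\<close>)
  have "measure \<mu> (set_pow G U n - set_pow G U (n - s))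
      \<le> C' * real n powr (- \<delta>) * measure \<mu> (set_pow G U n)" if n: "n \<ge> t0" for n
  proof -
    have "set_pow G U (n - t0) \<subseteq> set_pow G U (n - s)"
      using n by (intro U_sub) (auto simp: t0_def)
    then have "measure \<mu> (set_pow G U n - set_pow G U (n - s)) \<le> F n t0"
      unfolding F_def using U_pow_fmeasurable
      by (intro measure_mono_fmeasurable) (auto intro: fmeasurableD)
    then show ?thesis
      using decay[OF n] by linarith
  qed
  then show thesis
    using \<delta> that by blast
qed

lemma annulus_small:
  fixes \<epsilon> :: real
  assumes "\<epsilon> > 0"
  shows "\<forall>\<^sub>F n in sequentially. measure \<mu> (set_pow G U n - set_pow G U (n - s))
           \<le> \<epsilon> * measure \<mu> (set_pow G U n)"
proof -
  obtain \<delta> C N where \<delta>: "\<delta> > 0" "C > 0"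
    and decay: "\<And>n. n \<ge> N \<Longrightarrow> measure \<mu> (set_pow G U n - set_pow G U (n - s))
        \<le> C * real n powr (- \<delta>) * measure \<mu> (set_pow G U n)"
    using annulus_decay[of s] by blast
  have "((\<lambda>n. real n powr (- \<delta>)) \<longlongrightarrow> 0) sequentially"
    using \<delta> by (intro tendsto_neg_powr filterlim_real_sequentially) auto
  from tendsto_mult_left[OF this, of C]
  have "((\<lambda>n. C * real n powr (- \<delta>)) \<longlongrightarrow> 0) sequentially"
    by simp
  then have "\<forall>\<^sub>F n in sequentially. C * real n powr (- \<delta>) < \<epsilon>"
    using assms by (rule order_tendstoD)
  then show ?thesis
    using eventually_ge_at_top[of N]
  proof eventually_elim
    case (elim n)
    then show ?case
      using decay[of n] mult_right_mono[of "C * real n powr (- \<delta>)" \<epsilon> "measure \<mu> (set_pow G U n)"]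
      by simp
  qed
qed

text \<open>The decay estimates bound an annulus by the larger power of \<open>U\<close>. To replace it by the smaller one,
  absorb half of \<open>\<mu> (U\<^bsup>n + j\<^esup>)\<close> into the left-hand side.\<close>

lemma measure_U_pow_shift_le:
  "\<forall>\<^sub>F n in sequentially. measure \<mu> (set_pow G U (n + j)) \<le> 2 * measure \<mu> (set_pow G U n)"
proof -
  have "\<forall>\<^sub>F n in sequentially. measure \<mu> (set_pow G U (n + j) - set_pow G U n)
           \<le> 1 / 2 * measure \<mu> (set_pow G U (n + j))"
    using sequentially_offset[OF annulus_small[of "1 / 2" j], of j] by simp
  then show ?thesis
  proof eventually_elim
    case (elim n)
    have "measure \<mu> (set_pow G U (n + j))
        \<le> measure \<mu> (set_pow G U n \<union> (set_pow G U (n + j) - set_pow G U n))"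
      using U_pow_fmeasurable by (intro measure_mono_fmeasurable) (auto intro: fmeasurableD)
    also have "\<dots> \<le> measure \<mu> (set_pow G U n) + measure \<mu> (set_pow G U (n + j) - set_pow G U n)"
      using U_pow_fmeasurable by (intro measure_Un_le) (auto intro: fmeasurableD)
    finally show ?case
      using elim by simp
  qed
qed

text \<open>The estimate holds for large \<open>n\<close> by the decay of annuli of width \<open>1\<close>. The finitely many other \<open>n\<close>
  only affect the constant, since all powers of \<open>U\<close> have finite measure.\<close>

lemma sphere_bound:
  "\<exists>\<delta> C. \<delta> > (0::real) \<and> C \<ge> (1::real) \<and>
     (\<forall>n\<ge>1. emeasure \<mu> (set_pow G U n) > 0 \<longrightarrow>
        emeasure \<mu> (set_pow G U (n + 1) - set_pow G U n)
          \<le> ennreal (C * real n powr (- \<delta>)) * emeasure \<mu> (set_pow G U n))"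
proof -
  obtain \<delta> C N where \<delta>: "\<delta> > 0" "C > 0"
    and decay: "\<And>n. n \<ge> N \<Longrightarrow> measure \<mu> (set_pow G U n - set_pow G U (n - 1))
        \<le> C * real n powr (- \<delta>) * measure \<mu> (set_pow G U n)"
    using annulus_decay[of 1] by blast
  obtain N' where N': "\<And>n. n \<ge> N' \<Longrightarrow>
      measure \<mu> (set_pow G U (n + 1)) \<le> 2 * measure \<mu> (set_pow G U n)"
    using measure_U_pow_shift_le[of 1] by (auto simp: eventually_sequentially)
  define L where "L = max N N'"
  define r where "r = (\<lambda>n. measure \<mu> (set_pow G U (n + 1) - set_pow G U n)
      / measure \<mu> (set_pow G U n) * real n powr \<delta>)"
  define C' where "C' = 1 + 2 * C + (\<Sum>i<L. r i)"
  have r: "r i \<ge> 0" for i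
    by (simp add: r_def)
  then have sum_r: "(\<Sum>i<L. r i) \<ge> 0"
    by (intro sum_nonneg) auto
  have C': "C' \<ge> 1" "C' \<ge> 2 * C"
    using \<delta> sum_r by (auto simp: C'_def)
  have main: "measure \<mu> (set_pow G U (n + 1) - set_pow G U n)
      \<le> C' * real n powr (- \<delta>) * measure \<mu> (set_pow G U n)"
    if n: "n \<ge> 1" "measure \<mu> (set_pow G U n) > 0" for n
  proof (cases "n < L")
    case True
    then have "r n \<le> (\<Sum>i<L. r i)"
      using r by (intro member_le_sum) auto
    then have "r n \<le> C'"
      using \<delta> by (simp add: C'_def)
    then have "r n * real n powr (- \<delta>) * measure \<mu> (set_pow G U n)
        \<le> C' * real n powr (- \<delta>) * measure \<mu> (set_pow G U n)"
      by (intro mult_right_mono) auto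
    moreover have "r n * real n powr (- \<delta>) * measure \<mu> (set_pow G U n)
        = measure \<mu> (set_pow G U (n + 1) - set_pow G U n)"
      using n by (simp add: r_def powr_minus del: set_pow.simps)
    ultimately show ?thesis
      by simp
  next
    case False
    then have "measure \<mu> (set_pow G U (n + 1) - set_pow G U n)
        \<le> C * real (n + 1) powr (- \<delta>) * measure \<mu> (set_pow G U (n + 1))"
      using decay[of "n + 1"] by (simp add: L_def)
    also have "\<dots> \<le> C * real n powr (- \<delta>) * (2 * measure \<mu> (set_pow G U n))"
      using \<delta> n False N'[of n] by (intro mult_mono powr_mono2') (auto simp: L_def)
    also have "\<dots> = 2 * C * real n powr (- \<delta>) * measure \<mu> (set_pow G U n)"
      by simp
    also have "\<dots> \<le> C' * real n powr (- \<delta>) * measure \<mu> (set_pow G U n)"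
      using C' by (intro mult_right_mono) auto
    finally show ?thesis .
  qed
  have "emeasure \<mu> (set_pow G U (n + 1) - set_pow G U n)
          \<le> ennreal (C' * real n powr (- \<delta>)) * emeasure \<mu> (set_pow G U n)"
    if n: "n \<ge> 1" "emeasure \<mu> (set_pow G U n) > 0" for n
  proof -
    have diff: "set_pow G U (n + 1) - set_pow G U n \<in> fmeasurable \<mu>"
      by (rule fmeasurable_Diff[OF U_pow_fmeasurable fmeasurableD[OF U_pow_fmeasurable]])
    have "measure \<mu> (set_pow G U n) > 0"
      using n U_pow_fmeasurable[of n] by (simp add: emeasure_eq_measure2)
    then show ?thesis
      using main[OF n(1)] C' diff U_pow_fmeasurable[of n]
      by (simp add: emeasure_eq_measure2 ennreal_mult[symmetric] ennreal_leI del: set_pow.simps)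
  qed
  then show ?thesis
    using \<delta> C' by blast
qed

text \<open>If \<open>Q \<subseteq> U\<^sup>j\<close> and \<open>g \<in> Q\<close> with \<open>g\<inverse> \<in> U\<^sup>m\<close>, then \<open>U\<^bsup>n - m\<^esup> \<subseteq> g U\<^sup>n \<subseteq> Q U\<^sup>n \<subseteq> U\<^bsup>n + j\<^esup>\<close>. So the symmetric
  difference of \<open>Q U\<^sup>n\<close> and \<open>U\<^sup>n\<close> lies in two annuli of fixed width.\<close>

lemma folner_U_pow: "folner G T \<mu> (\<lambda>n. set_pow G U n)"
  unfolding folner_def
proof (intro conjI allI impI)
  show "set_pow G U n \<in> fmeasurable \<mu>" for n
    by (rule U_pow_fmeasurable)
next
  fix Q and n :: nat assume "compactin T Q \<and> Q \<noteq> {}"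
  then show "Q <#> set_pow G U n \<in> fmeasurable \<mu>"
    by (intro compactin_fmeasurable compactin_set_mult compactin_U_pow) auto
next
  fix Q assume "compactin T Q \<and> Q \<noteq> {}"
  then obtain g where Q: "compactin T Q" and g: "g \<in> Q"
    by blast
  then have gG: "g \<in> carrier G"
    using compactin_subset_carrier by blast
  obtain j where "\<And>i. i \<ge> j \<Longrightarrow> Q \<subseteq> set_pow G U i"
    using eventually_contains_compact[OF Q] by blast
  then have j: "Q \<subseteq> set_pow G U j"
    by simp
  obtain m where m: "inv g \<in> set_pow G U m"
    using generates inv_closed[OF gG] unfolding generating_def by blast
  have upper: "Q <#> set_pow G U n \<subseteq> set_pow G U (n + j)" for n
    using mono_set_mult[OF j order_refl, of G "set_pow G U n"]
    by (simp add: set_pow_add[OF U_subset_carrier] add.commute[of n j])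
  have lower: "set_pow G U (n - m) \<subseteq> Q <#> set_pow G U n" if "n \<ge> m" for n
  proof
    fix x assume x: "x \<in> set_pow G U (n - m)"
    then have "inv g \<otimes> x \<in> set_pow G U n"
      using set_pow_addI[OF U_subset_carrier m x, of n] that by simp
    moreover have "x = g \<otimes> (inv g \<otimes> x)"
      using subsetD[OF set_pow_closed[OF U_subset_carrier] x] gG
      by (simp add: m_assoc[symmetric])
    ultimately show "x \<in> Q <#> set_pow G U n"
      using g by (auto simp: set_mult_def)
  qed
  let ?D = "\<lambda>n. ((Q <#> set_pow G U n) - set_pow G U n) \<union> (set_pow G U n - (Q <#> set_pow G U n))"
  show "(\<lambda>n. measure \<mu> (?D n)) \<in> o(\<lambda>n. measure \<mu> (set_pow G U n))"
  proof (rule landau_o.smallI)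
    fix c :: real assume c: "c > 0"
    have "\<forall>\<^sub>F n in sequentially. measure \<mu> (set_pow G U (n + j) - set_pow G U n)
           \<le> c / 4 * measure \<mu> (set_pow G U (n + j))"
      using sequentially_offset[OF annulus_small[of "c / 4" j], of j] c by simp
    moreover have "\<forall>\<^sub>F n in sequentially. measure \<mu> (set_pow G U n - set_pow G U (n - m))
           \<le> c / 2 * measure \<mu> (set_pow G U n)"
      using annulus_small[of "c / 2" m] c by simp
    ultimately show "\<forall>\<^sub>F n in sequentially.
        norm (measure \<mu> (?D n)) \<le> c * norm (measure \<mu> (set_pow G U n))"
      using measure_U_pow_shift_le[of j] eventually_ge_at_top[of m]
    proof eventually_elim
      case (elim n)
      have QU: "Q <#> set_pow G U n \<in> sets \<mu>"
        by (intro fmeasurableD compactin_fmeasurable compactin_set_mult compactin_U_pow Q)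
      have "measure \<mu> (?D n) \<le> measure \<mu> ((set_pow G U (n + j) - set_pow G U n) \<union>
          (set_pow G U n - set_pow G U (n - m)))"
        using upper[of n] lower[of n] elim(4) QU U_pow_fmeasurable
        by (intro measure_mono_fmeasurable fmeasurable.Un fmeasurable_Diff)
          (auto intro: fmeasurableD)
      also have "\<dots> \<le> measure \<mu> (set_pow G U (n + j) - set_pow G U n) +
          measure \<mu> (set_pow G U n - set_pow G U (n - m))"
        using U_pow_fmeasurable by (intro measure_Un_le) (auto intro: fmeasurableD)
      also have "\<dots> \<le> c / 4 * (2 * measure \<mu> (set_pow G U n)) + c / 2 * measure \<mu> (set_pow G U n)"
        using elim(1,2,3) c
        by (intro add_mono order_trans[OF elim(1)] mult_left_mono) auto
      finally show ?case
        by simp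
    qed
  qed
qed

end

theorem corollary10:
  fixes G :: "('a, 'b) monoid_scheme"
    and T :: "'a topology"
    and \<mu> :: "'a measure"
    and U :: "'a set"
  assumes "locally_compact_group G T"
    and "left_haar_measure G T \<mu>"
    and "polynomial_growth G T \<mu>"
    and "compactin T U"
    and "generating G U"
    and aperiodic: "\<exists>k. \<one>\<^bsub>G\<^esub> \<in> set_pow G U k \<and> \<one>\<^bsub>G\<^esub> \<in> set_pow G U (k + 1)"
  shows "(\<exists>\<delta> C. \<delta> > (0::real) \<and> C \<ge> (1::real) \<and>
            (\<forall>n\<ge>1. emeasure \<mu> (set_pow G U n) > 0 \<longrightarrow>
               emeasure \<mu> (set_pow G U (n + 1) - set_pow G U n)
                 \<le> ennreal (C * real n powr (- \<delta>)) * emeasure \<mu> (set_pow G U n)))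
         \<and> folner G T \<mu> (\<lambda>n. set_pow G U n)"
proof -
  interpret haar_growth G T \<mu> U
    using assms by (simp add: haar_growth_def haar_growth_axioms_def haar_group_def
        haar_group_axioms_def locally_compact_group_def)
  show ?thesis
    using sphere_bound folner_U_pow by blast
qed

end
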